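(* Let $\mu=(\mu_0\geq\mu_1\geq\cdots\geq\mu_\ell\geq 1)$ be an integer partition with $\ell\geq 1$, and let $1\leq d\leq\mu_0$. Let $P_{\mu,d,n}(t)=\sum_{w\in\mathcal{A}_\mu(d,n)}t^{\mathrm{bigtiles}(w)}$, $\mathbf{F}_{\mu,d}(x,t)=\sum_{n\geq0}P_{\mu,d,n}(t)x^n$, and $B_{\mu,d}(x,t)=\sum_{w}x^{\mathrm{width}(w)}t^{\mathrm{bigtiles}(w)}$, where the last sum is over all fault-free anchor words $w$ for $\mu$ (of any length). Then \[ \mathbf{F}_{\mu,d}(x,t)=\frac{1}{1-B_{\mu,d}(x,t)}. \] In particular, writing $\alpha_j(t)\in\mathbb{N}[t]$ for the sum of $t^{\mathrm{bigtiles}(w)}$ over fault-free anchor words $w$ of length $j$, we have $\alpha_1=1$, $\alpha_j=0$ for $j>\ell d+1$, and for all $n\geq1$ (with $P_{\mu,d,m}=0$ for $m<0$) \[ P_{\mu,d,n}(t)=\sum_{j=1}^{\ell d+1}\alpha_j(t)\,P_{\mu,d,n-j}(t), \] a linear recursion of length at most $\ell d+1$ with coefficients in $\mathbb{N}[t]$.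
   Context: An anchor word for $\mu$ of length $n$ (with parameter $d$) is a word $a_1\cdots a_n$ over $\{1,\dotsc,d,\infty\}$ such that for every $i$ with $a_i\neq\infty$, $a_{i+k}\geq a_i+\mu_k$ for all $k=1,\dotsc,\ell$ ($\infty$ larger than every integer), and $a_{n-\ell+1}=\cdots=a_n=\infty$; $\mathcal{A}_\mu(d,n)$ is the set of these (the empty word for $n=0$). $\mathrm{bigtiles}(w)$ is the number of letters of $w$ different from $\infty$ and $\mathrm{width}(w)$ is the length of $w$. An anchor word is fault-free if it is either the one-letter word $(\infty)$, or it starts with an integer letter, ends with $\ell$ consecutive letters $\infty$, and this final block is the only occurrence of $\ell$ consecutive $\infty$'s in it. (These correspond to tilings of the board with $\mu_0+d-1$ rows by unit squares and translates of the Ferrers tile of $\mu$, the tile with bottom-justified columns of heights $\mu_0,\dotsc,\mu_\ell$, placing a tile with lower-left cell in column $i$, row $a_i$; fault-free words correspond to tilings with no vertical fault line.) *)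

theory Defs
  imports
    "HOL-Library.Extended_Nat"
    "HOL-Computational_Algebra.Polynomial"
    "HOL-Computational_Algebra.Formal_Power_Series"
begin

text \<open>
  A partition \<open>\<mu>\<^sub>0 \<ge> \<mu>\<^sub>1 \<ge> \<dots> \<ge> \<mu>\<^sub>l \<ge> 1\<close> is the list of its parts, so it has length \<open>l + 1\<close>.
\<close>

definition is_partition :: "nat list \<Rightarrow> bool" where
  "is_partition \<mu> \<longleftrightarrow> sorted_wrt (\<ge>) \<mu> \<and> (\<forall>m\<in>set \<mu>. 1 \<le> m)"

definition ell :: "nat list \<Rightarrow> nat" where
  "ell \<mu> = length \<mu> - 1"

text \<open>
  Words are lists over \<^typ>\<open>enat\<close>, indexed from 0. A word of length \<open>n \<le> l\<close>
  has to consist of \<open>\<infinity>\<close> only. The inequality is required for positions inside the word;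
  it never refers to others, since an integer letter lies before the final \<open>l\<close> letters.
\<close>

definition anchor_word :: "nat list \<Rightarrow> nat \<Rightarrow> enat list \<Rightarrow> bool" where
  "anchor_word \<mu> d w \<longleftrightarrow>
     set w \<subseteq> insert \<infinity> (enat ` {1..d}) \<and>
     (\<forall>i<length w. w ! i \<noteq> \<infinity> \<longrightarrow>
        (\<forall>k\<in>{1..ell \<mu>}. i + k < length w \<longrightarrow> w ! (i + k) \<ge> w ! i + enat (\<mu> ! k))) \<and>
     (\<forall>i<length w. length w \<le> i + ell \<mu> \<longrightarrow> w ! i = \<infinity>)"

definition anchor_words :: "nat list \<Rightarrow> nat \<Rightarrow> nat \<Rightarrow> enat list set" where
  "anchor_words \<mu> d n = {w. anchor_word \<mu> d w \<and> length w = n}"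

definition bigtiles :: "enat list \<Rightarrow> nat" where
  "bigtiles w = length (filter (\<lambda>a. a \<noteq> \<infinity>) w)"

abbreviation width :: "enat list \<Rightarrow> nat" where
  "width w \<equiv> length w"

definition fault_free :: "nat list \<Rightarrow> nat \<Rightarrow> enat list \<Rightarrow> bool" where
  "fault_free \<mu> d w \<longleftrightarrow> anchor_word \<mu> d w \<and>
     (w = [\<infinity>] \<or>
      w \<noteq> [] \<and> hd w \<noteq> \<infinity> \<and>
      (\<exists>u. w = u @ replicate (ell \<mu>) \<infinity>) \<and>
      (\<forall>u v. w = u @ replicate (ell \<mu>) \<infinity> @ v \<longrightarrow> v = []))"

definition P :: "nat list \<Rightarrow> nat \<Rightarrow> nat \<Rightarrow> nat poly" where
  "P \<mu> d n = (\<Sum>w\<in>anchor_words \<mu> d n. monom 1 (bigtiles w))"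

definition \<alpha> :: "nat list \<Rightarrow> nat \<Rightarrow> nat \<Rightarrow> nat poly" where
  "\<alpha> \<mu> d j = (\<Sum>w\<in>{w. fault_free \<mu> d w \<and> width w = j}. monom 1 (bigtiles w))"

text \<open>
  Power series in \<open>x\<close> over \<open>\<int>[t]\<close>. The sum defining \<open>B\<close>, over fault-free words of any
  length, is a formal one: its coefficient at \<open>x\<^sup>j\<close> collects the words of width \<open>j\<close>.
\<close>

definition F :: "nat list \<Rightarrow> nat \<Rightarrow> int poly fps" where
  "F \<mu> d = Abs_fps (\<lambda>n. map_poly int (P \<mu> d n))"

definition B :: "nat list \<Rightarrow> nat \<Rightarrow> int poly fps" where
  "B \<mu> d = Abs_fps (\<lambda>j. \<Sum>w\<in>{w. fault_free \<mu> d w \<and> width w = j}. monom 1 (bigtiles w))"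

text \<open>The sums above are over finite sets, so none of them is a default value.\<close>

lemma finite_anchor_words: "finite (anchor_words \<mu> d n)"
proof (rule finite_subset)
  show "anchor_words \<mu> d n \<subseteq> {w. set w \<subseteq> insert \<infinity> (enat ` {1..d}) \<and> length w = n}"
    by (auto simp: anchor_words_def anchor_word_def)
  show "finite {w. set w \<subseteq> insert \<infinity> (enat ` {1..d}) \<and> length w = n}"
    by (intro finite_lists_length_eq) simp
qed

lemma finite_fault_free_width: "finite {w. fault_free \<mu> d w \<and> width w = j}"
  by (rule finite_subset[OF _ finite_anchor_words[of \<mu> d j]])
     (auto simp: anchor_words_def fault_free_def)

end

theory Submission
  imports Defs
begin

text \<open>
  Cutting a nonempty anchor word after its first letter, if this is \<open>\<infinity>\<close>, and otherwise after
  its first block of \<open>l\<close> letters \<open>\<infinity>\<close>, splits it uniquely into a fault-free word and an anchor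
  word; conversely such words can be concatenated freely, because an integer letter constrains
  only the next \<open>l\<close> letters. In a fault-free word of width greater than 1, every integer letter
  is followed by a larger one at distance at most \<open>l\<close>, unless it is the last one; so there are
  at most \<open>d\<close> of them, and the width is at most \<open>l * d + 1\<close>.
\<close>

section \<open>Concatenating and cutting anchor words\<close>

text \<open>The assumption makes the last \<open>ell \<mu>\<close> letters of \<open>p\<close>
  infinite, so no inequality starting in \<open>p\<close> reaches into \<open>v\<close>. A prefix
  cut elsewhere may fail to be an anchor word.\<close>

lemma anchor_word_append:
  assumes "\<And>i. \<lbrakk>i < length p; length p \<le> i + ell \<mu>\<rbrakk> \<Longrightarrow> p ! i = \<infinity>"
  shows "anchor_word \<mu> d (p @ v) \<longleftrightarrow> anchor_word \<mu> d p \<and> anchor_word \<mu> d v"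
proof
  assume pv: "anchor_word \<mu> d (p @ v)"
  have letters: "set (p @ v) \<subseteq> insert \<infinity> (enat ` {1..d})"
    and gaps: "\<And>i k. \<lbrakk>i < length (p @ v); (p @ v) ! i \<noteq> \<infinity>; k \<in> {1..ell \<mu>}; i + k < length (p @ v)\<rbrakk>
      \<Longrightarrow> (p @ v) ! i + enat (\<mu> ! k) \<le> (p @ v) ! (i + k)"
    and final: "\<And>i. \<lbrakk>i < length (p @ v); length (p @ v) \<le> i + ell \<mu>\<rbrakk> \<Longrightarrow> (p @ v) ! i = \<infinity>"
    using pv unfolding anchor_word_def by blast+
  have "anchor_word \<mu> d p"
    unfolding anchor_word_def
  proof (intro conjI allI impI ballI)
    fix i k assume "i < length p" "p ! i \<noteq> \<infinity>" "k \<in> {1..ell \<mu>}" "i + k < length p"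
    then show "p ! i + enat (\<mu> ! k) \<le> p ! (i + k)"
      using gaps[of i k] by (simp add: nth_append)
  qed (use letters assms in auto)
  moreover have "anchor_word \<mu> d v"
    unfolding anchor_word_def
  proof (intro conjI allI impI ballI)
    fix i k assume "i < length v" "v ! i \<noteq> \<infinity>" "k \<in> {1..ell \<mu>}" "i + k < length v"
    then show "v ! i + enat (\<mu> ! k) \<le> v ! (i + k)"
      using gaps[of "length p + i" k] by (simp add: nth_append)
  next
    fix i assume "i < length v" "length v \<le> i + ell \<mu>"
    then show "v ! i = \<infinity>"
      using final[of "length p + i"] by (simp add: nth_append)
  qed (use letters in auto)
  ultimately show "anchor_word \<mu> d p \<and> anchor_word \<mu> d v" ..
next
  assume "anchor_word \<mu> d p \<and> anchor_word \<mu> d v"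
  then have p: "anchor_word \<mu> d p" and v: "anchor_word \<mu> d v" by auto
  show "anchor_word \<mu> d (p @ v)"
    unfolding anchor_word_def
  proof (intro conjI allI impI ballI)
    show "set (p @ v) \<subseteq> insert \<infinity> (enat ` {1..d})"
      using p v by (auto simp: anchor_word_def)
  next
    fix i k assume i: "i < length (p @ v)" "(p @ v) ! i \<noteq> \<infinity>"
      and k: "k \<in> {1..ell \<mu>}" "i + k < length (p @ v)"
    show "(p @ v) ! i + enat (\<mu> ! k) \<le> (p @ v) ! (i + k)"
    proof (cases "i < length p")
      case True
      \<comment> \<open>By contraposition of the assumption: an integer letter of \<open>p\<close>
        lies before its final block.\<close>
      with i assms[of i] have "i + ell \<mu> < length p"
        by (force simp: nth_append)
      with k have "i + k < length p" by auto
      with True i k p show ?thesis by (simp add: anchor_word_def nth_append)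
    next
      case False
      then obtain i' where "i = length p + i'"
        by (metis le_add_diff_inverse linorder_not_le)
      with i k v show ?thesis by (simp add: anchor_word_def nth_append add.assoc)
    qed
  next
    fix i assume "i < length (p @ v)" "length (p @ v) \<le> i + ell \<mu>"
    then show "(p @ v) ! i = \<infinity>"
      using assms[of i] v by (auto simp: nth_append anchor_word_def)
  qed
qed

section \<open>Unique splitting off of a fault-free word\<close>

lemma fault_free_anchor_word: "fault_free \<mu> d w \<Longrightarrow> anchor_word \<mu> d w"
  by (simp add: fault_free_def)

lemma fault_free_not_Nil: "fault_free \<mu> d w \<Longrightarrow> w \<noteq> []"
  by (auto simp: fault_free_def)

lemma fault_free_append_anchor_word:
  assumes "fault_free \<mu> d p" "anchor_word \<mu> d v"
  shows "anchor_word \<mu> d (p @ v)"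
proof -
  have "anchor_word \<mu> d p" using assms(1) by (rule fault_free_anchor_word)
  with assms(2) show ?thesis
    by (subst anchor_word_append) (auto simp: anchor_word_def)
qed

lemma fault_free_singleton: "ell \<mu> \<ge> 1 \<Longrightarrow> fault_free \<mu> d [\<infinity>]"
  by (simp add: fault_free_def anchor_word_def)

text \<open>The block ending \<open>p\<close> also occurs in \<open>p @ z\<close>, where the only
  block is the final one. If \<open>p = [\<infinity>]\<close>, then \<open>p @ z\<close> starts with
  \<infinity> and must be \<open>[\<infinity>]\<close> itself.\<close>

lemma fault_free_prefix_eq:
  assumes "fault_free \<mu> d p" "fault_free \<mu> d (p @ z)"
  shows "z = []"
proof (cases "p = [\<infinity>]")
  case True
  with assms(2) show ?thesis by (auto simp: fault_free_def)
next
  case False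
  with assms(1) obtain u where u: "p = u @ replicate (ell \<mu>) \<infinity>"
    and p: "hd p \<noteq> \<infinity>" "p \<noteq> []"
    unfolding fault_free_def by blast
  from p have "p @ z \<noteq> [\<infinity>]" by (cases p) auto
  moreover have "p @ z = u @ replicate (ell \<mu>) \<infinity> @ z" using u by simp
  ultimately show ?thesis using assms(2) unfolding fault_free_def by blast
qed

text \<open>Of two prefixes of the same word, one is a prefix of the other.\<close>

lemma fault_free_factor_unique:
  assumes "fault_free \<mu> d p" "fault_free \<mu> d q" "p @ v = q @ w"
  shows "p = q \<and> v = w"
proof -
  from assms(3) obtain z where "p @ z = q \<and> v = z @ w \<or> p = q @ z \<and> z @ v = w"
    by (auto simp: append_eq_append_conv2)
  with assms(1,2) show ?thesis
    using fault_free_prefix_eq by fastforce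
qed

lemma fault_free_factor_exists:
  assumes w: "anchor_word \<mu> d w" and ne: "w \<noteq> []" and l: "ell \<mu> \<ge> 1"
  shows "\<exists>p v. w = p @ v \<and> fault_free \<mu> d p \<and> anchor_word \<mu> d v"
proof (cases "hd w = \<infinity>")
  case True
  with ne have eq: "w = [\<infinity>] @ tl w" by (cases w) auto
  have "anchor_word \<mu> d ([\<infinity>] @ tl w)" using w eq by simp
  then have "anchor_word \<mu> d (tl w)" by (subst (asm) anchor_word_append) auto
  with eq fault_free_singleton[OF l] show ?thesis by blast
next
  case hd: False
  let ?I = "replicate (ell \<mu>) \<infinity>"
  define blk where "blk k \<longleftrightarrow> take (ell \<mu>) (drop k w) = ?I" for k
  have final: "\<And>i. \<lbrakk>i < length w; length w \<le> i + ell \<mu>\<rbrakk> \<Longrightarrow> w ! i = \<infinity>"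
    using w by (simp add: anchor_word_def)
  have len: "ell \<mu> < length w"
    using final[of 0] hd ne by (force simp: hd_conv_nth)
  \<comment> \<open>The final letters of \<open>w\<close> form a block, so the \<open>LEAST\<close>
    below is attained.\<close>
  have "blk (length w - ell \<mu>)"
    unfolding blk_def by (rule nth_equalityI) (use len final in auto)
  then have blk: "blk (LEAST k. blk k)" by (rule LeastI)
  define k where "k = (LEAST k. blk k)"
  define p where "p = take k w @ ?I"
  define v where "v = drop (k + ell \<mu>) w"
  have k: "take (ell \<mu>) (drop k w) = ?I" using blk by (simp add: k_def blk_def)
  have eq: "w = p @ v"
    using append_take_drop_id[of k w] append_take_drop_id[of "ell \<mu>" "drop k w"] k
    by (simp add: p_def v_def add.commute)
  \<comment> \<open>Comparing lengths gives \<open>ell \<mu> \<le> length w - k\<close>; since the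
    subtraction is truncated, \<open>ell \<mu> \<ge> 1\<close> is needed to conclude.\<close>
  have klen: "k + ell \<mu> \<le> length w"
    using arg_cong[OF k, of length] l by (auto simp: min_def split: if_splits)
  then have plen: "length p = k + ell \<mu>" by (simp add: p_def)
  have pfinal: "p ! i = \<infinity>" if "i < length p" "length p \<le> i + ell \<mu>" for i
    using that klen plen by (simp add: p_def nth_append)
  have av: "anchor_word \<mu> d p \<and> anchor_word \<mu> d v"
    using w eq anchor_word_append[OF pfinal] by simp
  have pne: "p \<noteq> []" using plen l by auto
  \<comment> \<open>A block inside \<open>p\<close> is a block of \<open>w\<close>, so by minimality
    of \<open>k\<close> it starts no earlier than the one ending \<open>p\<close>.\<close>
  have "z = []" if "p = u @ ?I @ z" for u z
  proof -
    have "blk (length u)" using eq that by (simp add: blk_def)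
    then have "k \<le> length u" by (simp add: k_def Least_le)
    moreover have "length p = length u + ell \<mu> + length z" using that by simp
    ultimately show ?thesis using plen by simp
  qed
  moreover have "hd p \<noteq> \<infinity>" using hd eq pne by simp
  ultimately have "fault_free \<mu> d p"
    using av pne by (auto simp: fault_free_def p_def)
  with eq av show ?thesis by blast
qed

text \<open>The component \<open>j\<close> is determined by \<open>p\<close>; it is carried along so
  that a sum over this set splits by the width of the first factor.\<close>

lemma bij_betw_fault_free_factor:
  assumes "ell \<mu> \<ge> 1" "n \<ge> 1"
  shows "bij_betw (\<lambda>(j, p, v). p @ v)
    (SIGMA j:{1..n}. {w. fault_free \<mu> d w \<and> width w = j} \<times> anchor_words \<mu> d (n - j))
    (anchor_words \<mu> d n)"
  unfolding bij_betw_def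
proof
  show "inj_on (\<lambda>(j, p, v). p @ v)
      (SIGMA j:{1..n}. {w. fault_free \<mu> d w \<and> width w = j} \<times> anchor_words \<mu> d (n - j))"
    by (rule inj_onI) (auto dest: fault_free_factor_unique)
  show "(\<lambda>(j, p, v). p @ v) `
      (SIGMA j:{1..n}. {w. fault_free \<mu> d w \<and> width w = j} \<times> anchor_words \<mu> d (n - j))
      = anchor_words \<mu> d n"
  proof (intro equalityI subsetI)
    fix w assume "w \<in> anchor_words \<mu> d n"
    then have w: "anchor_word \<mu> d w" "length w = n" by (auto simp: anchor_words_def)
    with assms obtain p v where pv: "w = p @ v" "fault_free \<mu> d p" "anchor_word \<mu> d v"
      using fault_free_factor_exists[of \<mu> d w] by force
    then have "length p \<ge> 1" using fault_free_not_Nil[of \<mu> d p] by (cases p) auto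
    with pv w show "w \<in> (\<lambda>(j, p, v). p @ v) `
      (SIGMA j:{1..n}. {w. fault_free \<mu> d w \<and> width w = j} \<times> anchor_words \<mu> d (n - j))"
      by (intro image_eqI[of _ _ "(length p, p, v)"]) (auto simp: anchor_words_def)
  qed (auto simp: anchor_words_def fault_free_append_anchor_word)
qed

section \<open>Recursion by the first factor and the power series identity\<close>

text \<open>Additivity of \<open>bigtiles\<close> turns concatenation into a product of monomials.
  The coefficient type is general because \<open>P\<close> and \<alpha> live over
  \<open>nat\<close>, while \<open>F\<close> and \<open>B\<close> live over
  \<open>int\<close>.\<close>

lemma sum_anchor_words_rec:
  assumes "ell \<mu> \<ge> 1" "n \<ge> 1"
  shows "(\<Sum>w\<in>anchor_words \<mu> d n. monom 1 (bigtiles w) :: 'a::comm_semiring_1 poly) =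
    (\<Sum>j=1..n. (\<Sum>p\<in>{w. fault_free \<mu> d w \<and> width w = j}. monom 1 (bigtiles p)) *
      (\<Sum>v\<in>anchor_words \<mu> d (n - j). monom 1 (bigtiles v)))"
proof -
  have "(\<Sum>w\<in>anchor_words \<mu> d n. monom 1 (bigtiles w) :: 'a poly) =
    (\<Sum>(j, p, v)\<in>(SIGMA j:{1..n}. {w. fault_free \<mu> d w \<and> width w = j} \<times>
       anchor_words \<mu> d (n - j)). monom 1 (bigtiles p) * monom 1 (bigtiles v))"
    by (subst sum.reindex_bij_betw[OF bij_betw_fault_free_factor[OF assms], symmetric])
      (simp add: case_prod_beta bigtiles_def mult_monom)
  also have "\<dots> = (\<Sum>j=1..n. \<Sum>(p, v)\<in>{w. fault_free \<mu> d w \<and> width w = j} \<times>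
       anchor_words \<mu> d (n - j). monom 1 (bigtiles p) * monom 1 (bigtiles v))"
    by (subst sum.Sigma) (auto simp: finite_anchor_words finite_fault_free_width)
  finally show ?thesis
    by (simp add: sum_product sum.cartesian_product)
qed

lemma map_poly_int_P:
  "map_poly int (P \<mu> d n) = (\<Sum>w\<in>anchor_words \<mu> d n. monom 1 (bigtiles w))"
  by (rule poly_eqI) (auto simp: P_def coeff_map_poly coeff_sum intro!: sum.cong)

lemma anchor_words_0: "anchor_words \<mu> d 0 = {[]}"
  by (auto simp: anchor_words_def anchor_word_def)

lemma B_nth_0: "fps_nth (B \<mu> d) 0 = 0"
  by (auto simp: B_def intro!: sum.neutral dest: fault_free_not_Nil)

lemma F_eq_1_plus_B_mult_F:
  assumes "ell \<mu> \<ge> 1"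
  shows "F \<mu> d = 1 + B \<mu> d * F \<mu> d"
proof (rule fps_ext)
  fix n
  show "fps_nth (F \<mu> d) n = fps_nth (1 + B \<mu> d * F \<mu> d) n"
  proof (cases "n = 0")
    \<comment> \<open>The constant term 1 comes from the empty word.\<close>
    case True
    then show ?thesis
      by (simp add: fps_mult_nth B_nth_0 F_def map_poly_int_P anchor_words_0 bigtiles_def)
  next
    case False
    then have "(\<Sum>i=0..n. fps_nth (B \<mu> d) i * fps_nth (F \<mu> d) (n - i)) =
        (\<Sum>i=1..n. fps_nth (B \<mu> d) i * fps_nth (F \<mu> d) (n - i))"
      by (subst sum.atLeast_Suc_atMost) (simp_all add: B_nth_0)
    with False assms show ?thesis
      by (simp add: fps_mult_nth) (simp add: F_def B_def map_poly_int_P sum_anchor_words_rec)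
  qed
qed

section \<open>Bounding the width of fault-free words\<close>

text \<open>From the letter \<open>a\<close> on, integer letters can be chosen strictly increasing
  in \<open>{a..d}\<close>, at most \<open>Suc d - a\<close> of them, each costing at most
  \<open>ell \<mu>\<close> further positions; the 1 counts position \<open>i\<close> itself.\<close>

lemma fault_free_width_le_from_letter:
  assumes part: "is_partition \<mu>" and w: "fault_free \<mu> d w"
    and i: "i < length w" "w ! i = enat a"
  shows "length w \<le> i + ell \<mu> * (Suc d - a) + 1"
  using i
proof (induction "d - a" arbitrary: i a rule: less_induct)
  case less
  have aw: "anchor_word \<mu> d w" using w by (rule fault_free_anchor_word)
  have bound: "1 \<le> b \<and> b \<le> d" if "j < length w" "w ! j = enat b" for j b
  proof -
    have "w ! j \<in> insert \<infinity> (enat ` {1..d})"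
      using aw nth_mem[OF that(1)] unfolding anchor_word_def by blast
    with that(2) show ?thesis by auto
  qed
  have a: "a \<le> d" using bound less.prems by blast
  show ?case
  proof (cases "length w \<le> i + ell \<mu> + 1")
    case True
    with a show ?thesis by (simp add: Suc_diff_le)
  next
    case False
    \<comment> \<open>Otherwise the \<open>ell \<mu>\<close> letters after position \<open>i\<close>
      would form a block, with further letters behind it.\<close>
    have "\<exists>k\<in>{1..ell \<mu>}. w ! (i + k) \<noteq> \<infinity>"
    proof (rule ccontr)
      assume "\<not> ?thesis"
      then have inf: "w ! (i + k) = \<infinity>" if "k \<in> {1..ell \<mu>}" for k using that by blast
      have "take (ell \<mu>) (drop (Suc i) w) = replicate (ell \<mu>) \<infinity>"
      proof (rule nth_equalityI)
        fix m assume "m < length (take (ell \<mu>) (drop (Suc i) w))"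
        then show "take (ell \<mu>) (drop (Suc i) w) ! m = replicate (ell \<mu>) \<infinity> ! m"
          using inf[of "Suc m"] False by simp
      qed (use False in simp)
      then have "w = take (Suc i) w @ replicate (ell \<mu>) \<infinity> @ drop (ell \<mu>) (drop (Suc i) w)"
        by (metis append_take_drop_id)
      moreover have "w \<noteq> [\<infinity>]" using less.prems by auto
      ultimately have "drop (ell \<mu>) (drop (Suc i) w) = []"
        using w unfolding fault_free_def by blast
      with False show False by simp
    qed
    then obtain k b where k: "k \<in> {1..ell \<mu>}" and b: "w ! (i + k) = enat b" by auto
    have ik: "i + k < length w" using False k by simp
    have "w ! i + enat (\<mu> ! k) \<le> w ! (i + k)"
      using aw less.prems k ik unfolding anchor_word_def by (metis enat.distinct(1))
    \<comment> \<open>Parts being at least 1 makes the next letter strictly larger.\<close>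
    moreover have "\<mu> ! k \<ge> 1"
      using part k by (auto simp: is_partition_def ell_def)
    ultimately have ab: "a < b" using less.prems b by simp
    \<comment> \<open>Together with \<open>a < b\<close> this gives \<open>d - b < d - a\<close> for
      the induction, despite truncated subtraction.\<close>
    have bd: "b \<le> d" using bound ik b by blast
    have "length w \<le> i + k + ell \<mu> * (Suc d - b) + 1"
      using less.hyps[OF _ ik b] ab bd by simp
    also have "\<dots> \<le> i + (ell \<mu> + ell \<mu> * (Suc d - b)) + 1" using k by simp
    also have "ell \<mu> + ell \<mu> * (Suc d - b) = ell \<mu> * Suc (Suc d - b)" by simp
    also have "i + ell \<mu> * Suc (Suc d - b) + 1 \<le> i + ell \<mu> * (Suc d - a) + 1"
      using ab bd by (intro add_mono mult_le_mono) auto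
    finally show ?thesis by simp
  qed
qed

lemma fault_free_width_le:
  assumes "is_partition \<mu>" "fault_free \<mu> d w"
  shows "length w \<le> ell \<mu> * d + 1"
proof (cases "w = [\<infinity>]")
  case False
  with assms(2) have ne: "w \<noteq> []" and "hd w \<noteq> \<infinity>" by (auto simp: fault_free_def)
  then obtain a where a: "w ! 0 = enat a" by (auto simp: hd_conv_nth)
  have "w ! 0 \<in> insert \<infinity> (enat ` {1..d})"
    using fault_free_anchor_word[OF assms(2)] ne nth_mem[of 0 w] unfolding anchor_word_def by blast
  with a have "1 \<le> a" by auto
  then have "ell \<mu> * (Suc d - a) \<le> ell \<mu> * d" by (intro mult_le_mono) auto
  moreover have "length w \<le> 0 + ell \<mu> * (Suc d - a) + 1"
    using assms a by (intro fault_free_width_le_from_letter) (use ne in auto)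
  ultimately show ?thesis by linarith
qed simp

section \<open>Coefficients of the linear recursion\<close>

lemma \<alpha>_eq_0: "is_partition \<mu> \<Longrightarrow> j > ell \<mu> * d + 1 \<Longrightarrow> \<alpha> \<mu> d j = 0"
  unfolding \<alpha>_def by (rule sum.neutral) (use fault_free_width_le in force)

text \<open>As \<open>ell \<mu> \<ge> 1\<close>, a single letter belongs to the final stretch and is
  \<infinity>.\<close>

lemma \<alpha>_1:
  assumes "ell \<mu> \<ge> 1"
  shows "\<alpha> \<mu> d 1 = 1"
proof -
  have "w = [\<infinity>]" if "anchor_word \<mu> d w" "length w = 1" for w
  proof -
    from that(2) obtain a where "w = [a]" by (auto simp: length_Suc_conv)
    with that(1) assms show ?thesis by (simp add: anchor_word_def)
  qed
  then have "{w. fault_free \<mu> d w \<and> width w = 1} = {[\<infinity>]}"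
    using fault_free_singleton[OF assms] fault_free_anchor_word by auto
  then show ?thesis by (simp add: \<alpha>_def bigtiles_def monom_0 one_pCons)
qed

text \<open>The ranges \<open>{1..n}\<close> and \<open>{1..ell \<mu> * d + 1}\<close> are compared
  through their intersection: outside it either \<alpha> vanishes by the width bound or the
  \<open>if\<close> yields 0.\<close>

lemma P_rec:
  assumes "is_partition \<mu>" "ell \<mu> \<ge> 1" "n \<ge> 1"
  shows "P \<mu> d n =
    (\<Sum>j=1..ell \<mu> * d + 1. \<alpha> \<mu> d j * (if j \<le> n then P \<mu> d (n - j) else 0))"
proof -
  have "P \<mu> d n = (\<Sum>j=1..n. \<alpha> \<mu> d j * P \<mu> d (n - j))"
    unfolding P_def \<alpha>_def using assms(2,3) by (rule sum_anchor_words_rec)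
  also have "\<dots> = (\<Sum>j=1..n. \<alpha> \<mu> d j * (if j \<le> n then P \<mu> d (n - j) else 0))"
    by (rule sum.cong) auto
  also have "\<dots> = (\<Sum>j\<in>{1..n} \<inter> {1..ell \<mu> * d + 1}.
      \<alpha> \<mu> d j * (if j \<le> n then P \<mu> d (n - j) else 0))"
    by (rule sum.mono_neutral_right) (use \<alpha>_eq_0[OF assms(1)] in auto)
  also have "\<dots> = (\<Sum>j=1..ell \<mu> * d + 1. \<alpha> \<mu> d j * (if j \<le> n then P \<mu> d (n - j) else 0))"
    by (rule sum.mono_neutral_left) auto
  finally show ?thesis .
qed

text \<open>As \<open>int poly\<close> is not a field, the quotient is expressed by a product equal
  to 1 and by \<open>fps_right_inverse\<close>, whose argument 1 inverts the constant coefficient 1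
  of \<open>1 - B \<mu> d\<close>.\<close>

theorem theorem4p13:
  fixes \<mu> :: "nat list" and l d :: nat
  assumes "is_partition \<mu>" and "length \<mu> = l + 1" and "l \<ge> 1"
    and "1 \<le> d" and "d \<le> \<mu> ! 0"
  shows "F \<mu> d * (1 - B \<mu> d) = 1 \<and> F \<mu> d = fps_right_inverse (1 - B \<mu> d) 1 \<and>
    \<alpha> \<mu> d 1 = 1 \<and>
    (\<forall>j > l * d + 1. \<alpha> \<mu> d j = 0) \<and>
    (\<forall>n\<ge>1. P \<mu> d n =
       (\<Sum>j = 1..l * d + 1. \<alpha> \<mu> d j * (if j \<le> n then P \<mu> d (n - j) else 0)))"
proof -
  have ell: "ell \<mu> = l" using assms(2) by (simp add: ell_def)
  with assms(3) have l: "ell \<mu> \<ge> 1" by simp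
  have inv: "F \<mu> d * (1 - B \<mu> d) = 1"
    using F_eq_1_plus_B_mult_F[OF l, of d] by (simp add: algebra_simps)
  have rinv: "(1 - B \<mu> d) * fps_right_inverse (1 - B \<mu> d) 1 = 1"
    by (intro fps_right_inverse) (simp add: B_nth_0)
  have "F \<mu> d = F \<mu> d * (1 - B \<mu> d) * fps_right_inverse (1 - B \<mu> d) 1"
    by (simp only: mult.assoc rinv mult_1_right)
  then have "F \<mu> d = fps_right_inverse (1 - B \<mu> d) 1" by (simp only: inv mult_1_left)
  with inv \<alpha>_1[OF l] \<alpha>_eq_0[OF assms(1)] P_rec[OF assms(1) l] show ?thesis
    unfolding ell by blast
qed

end
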